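(* Let $f$ be a convex quartic polynomial on $\mathbb{E}$ with positive definite quartic form $f_4$ satisfying $\mu\|x\|^4\le f_4[x]^4\le L\|x\|^4$ for all $x\in\mathbb{E}$ with constants $0<\mu\le L$, let $q=\mu/L$, let $\psi$ be a closed convex function, and let $\{x_k\}_{k\ge0}$ be generated by the Relaxed Quartic Newton Method (described in the context) with parameter $\tau\in\left(\frac13,\frac12\right)$ for the problem $F^*=\min_{x\in\mathrm{dom}\,\psi}[F(x)=f(x)+\psi(x)]$. Let the parameter $\tau$ satisfy the condition $$\alpha\le\min\left\{\frac{3\tau-1}{3\tau+1},\ \left[q\cdot\frac{1-2\tau}{1+2\tau}\right]^{1/3}\right\}$$ for some $\alpha>0$. Then, for all $k\ge0$, we have $$F(x_k)-F^*\le(1-\alpha)^k\,(F(x_0)-F^* ).$$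
   Context: $\mathbb{E}$ is a finite-dimensional real vector space with dual pairing $\langle\cdot,\cdot\rangle$ and an arbitrary norm $\|\cdot\|$. $f:\mathbb{E}\to\mathbb{R}$ is a convex polynomial of degree four and $f_4=\frac1{24}D^4f$ is its symmetric $4$-linear form, $f_4[x]^4=f_4[x,x,x,x]$; positive definiteness means $f_4[x]^4>0$ for all $x\ne0$. $\psi$ is a closed convex function with nonempty domain $\mathrm{dom}\,\psi\subseteq\mathbb{E}$. Put $$\hat\phi_{x,\tau}(y)=f(x)+\langle\nabla f(x),y-x\rangle+\frac{1+3\tau}{6\tau}\langle\nabla^2f(x)(y-x),y-x\rangle+(1+2\tau)L\|y-x\|^4 .$$ Relaxed Quartic Newton Method: choose $x_0\in\mathrm{dom}\,\psi$ and $\tau\in\left(\frac13,\frac12\right)$; for $k\ge0$ let $x_{k+1}$ be a minimizer over $y\in\mathrm{dom}\,\psi$ of $\hat\phi_{x_k,\tau}(y)+\psi(y)$. *)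

theory Defs
  imports "HOL-Analysis.Analysis"
begin

text \<open>
  Polynomials of degree at most \<open>n\<close>: the closure conditions of
  \<^const>\<open>real_polynomial_function\<close>, with the degree tracked. On a finite-dimensional space
  every linear functional is bounded.
\<close>

inductive polynomial_of_degree_le :: "nat \<Rightarrow> ('a::real_normed_vector \<Rightarrow> real) \<Rightarrow> bool" where
  const: "polynomial_of_degree_le n (\<lambda>x. c)"
| linear: "bounded_linear l \<Longrightarrow> polynomial_of_degree_le (Suc n) l"
| add: "polynomial_of_degree_le n f \<Longrightarrow> polynomial_of_degree_le n g
    \<Longrightarrow> polynomial_of_degree_le n (\<lambda>x. f x + g x)"
| mult: "polynomial_of_degree_le m f \<Longrightarrow> polynomial_of_degree_le n g
    \<Longrightarrow> polynomial_of_degree_le (m + n) (\<lambda>x. f x * g x)"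

text \<open>
  \<open>dir_deriv f x [h\<^sub>1, \<dots>, h\<^sub>p]\<close> is \<open>D\<^sup>p f(x)[h\<^sub>1, \<dots>, h\<^sub>p]\<close>; in particular
  \<open>dir_deriv f x [u]\<close> is the dual pairing of \<open>\<nabla>f(x)\<close> with \<open>u\<close>, and \<open>dir_deriv f x [u, v]\<close>
  that of \<open>\<nabla>\<^sup>2f(x) u\<close> with \<open>v\<close>.
\<close>

fun dir_deriv :: "('a::real_normed_vector \<Rightarrow> real) \<Rightarrow> 'a \<Rightarrow> 'a list \<Rightarrow> real" where
  "dir_deriv f x [] = f x"
| "dir_deriv f x (h # hs) = frechet_derivative (\<lambda>z. dir_deriv f z hs) (at x) h"

text \<open>
  For a polynomial of degree at most 4 the fourth derivative does not depend on the base point,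
  which is taken to be \<open>0\<close>.
\<close>

definition quartic_form :: "('a::real_normed_vector \<Rightarrow> real) \<Rightarrow> 'a \<Rightarrow> 'a \<Rightarrow> 'a \<Rightarrow> 'a \<Rightarrow> real" where
  "quartic_form f h1 h2 h3 h4 = (1 / 24) * dir_deriv f 0 [h1, h2, h3, h4]"

text \<open>
  An extended-valued function is represented by its effective domain \<open>D\<close> and its (finite)
  values on \<open>D\<close>; values outside \<open>D\<close> are irrelevant. Note that \<^const>\<open>convex_on\<close> includes
  convexity of \<open>D\<close>.
\<close>

definition closed_convex_function :: "'a::real_normed_vector set \<Rightarrow> ('a \<Rightarrow> real) \<Rightarrow> bool" where
  "closed_convex_function D \<psi> \<longleftrightarrow> D \<noteq> {} \<and> convex_on D \<psi> \<and> closed (epigraph D \<psi>)"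

definition relaxed_model ::
  "('a::real_normed_vector \<Rightarrow> real) \<Rightarrow> real \<Rightarrow> real \<Rightarrow> 'a \<Rightarrow> 'a \<Rightarrow> real" where
  "relaxed_model f L \<tau> x y =
     f x + dir_deriv f x [y - x]
     + (1 + 3 * \<tau>) / (6 * \<tau>) * dir_deriv f x [y - x, y - x]
     + (1 + 2 * \<tau>) * L * norm (y - x) ^ 4"

definition relaxed_quartic_newton ::
  "('a::real_normed_vector \<Rightarrow> real) \<Rightarrow> 'a set \<Rightarrow> ('a \<Rightarrow> real) \<Rightarrow> real \<Rightarrow> real \<Rightarrow> (nat \<Rightarrow> 'a) \<Rightarrow> bool"
where
  "relaxed_quartic_newton f D \<psi> L \<tau> x \<longleftrightarrow>
     x 0 \<in> D \<and>
     (\<forall>k. is_arg_min (\<lambda>y. relaxed_model f L \<tau> (x k) y + \<psi> y) (\<lambda>y. y \<in> D) (x (Suc k)))"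

end

theory Submission
  imports Defs
begin

text \<open>
  Restrict \<open>f\<close> to a line through \<open>x\<close> in the direction \<open>h\<close>. It becomes a univariate convex quartic
  \[ f(x + t h) = f(x) + a t + \frac{b}{2} t^2 + \frac{c}{6} t^3 + d t^4, \qquad d = f_4[h]^4, \]
  whose second derivative \<open>b + c t + 12 d t\<^sup>2\<close> is nonnegative for every real \<open>t\<close>. Evaluating this
  at \<open>t = \<tau>\<close> and at \<open>t = -\<tau>\<close> bounds the cubic term by the neighbouring even ones,
  \<open>\<bar>c\<bar> \<le> b / \<tau> + 12 d \<tau>\<close>, and therefore
  \[ \tfrac{3\tau-1}{6\tau} b + (1 - 2\tau) d \;\le\; f(x+h) - f(x) - a \;\le\;
     \tfrac{3\tau+1}{6\tau} b + (1 + 2\tau) d \]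
  (\<open>convex_quartic_sandwich\<close>). The right-hand side with \<open>d \<le> L \<parallel>h\<parallel>\<^sup>4\<close> is the model of the method,
  so the model majorizes \<open>f\<close>. On the other hand, what the model adds to the linearization of \<open>f\<close> is
  quadratic and quartic in the step, so it shrinks faster than linearly when the step is shortened:
  replacing \<open>h\<close> by
  \<open>\<alpha> h\<close> multiplies \<open>b\<close> by \<open>\<alpha>\<^sup>2\<close> and \<open>\<parallel>h\<parallel>\<^sup>4\<close> by \<open>\<alpha>\<^sup>4\<close>. The two bounds on \<open>\<alpha>\<close> say exactly that one
  factor \<open>\<alpha>\<close> brings the upper coefficient of \<open>b\<close> down to the lower one, and that \<open>\<alpha>\<^sup>3\<close> brings the
  model's quartic term \<open>(1 + 2\<tau>) L \<parallel>h\<parallel>\<^sup>4\<close> below \<open>(1 - 2\<tau>) \<mu> \<parallel>h\<parallel>\<^sup>4 \<le> (1 - 2\<tau>) d\<close>.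
  Thus the model at \<open>x + \<alpha> (z - x)\<close> is at most
  \<open>(1 - \<alpha>) f(x) + \<alpha> f(z)\<close> (\<open>relaxed_model_shortened_step\<close>).

  Comparing the minimizer of the model plus \<open>\<psi>\<close> with the point \<open>x\<^sub>k + \<alpha> (z - x\<^sub>k)\<close> gives
  \<open>F(x\<^sub>k\<^sub>+\<^sub>1) \<le> (1 - \<alpha>) F(x\<^sub>k) + \<alpha> F(z)\<close> for every \<open>z\<close> in the domain of \<open>\<psi>\<close>. This inequality
  also bounds \<open>F\<close> from below on the domain; taking the infimum over \<open>z\<close> contracts the gap
  \<open>F(x\<^sub>k) - F\<^sup>*\<close> by the factor \<open>1 - \<alpha>\<close>.
\<close>

section \<open>Directional derivatives of polynomials\<close>

lemma polynomial_degree_0_const: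
  assumes "polynomial_of_degree_le 0 f"
  shows "\<exists>c. f = (\<lambda>x. c)"
proof -
  have "n = 0 \<longrightarrow> (\<exists>c. f = (\<lambda>x. c))" if "polynomial_of_degree_le n f" for n
    using that by induction auto
  then show ?thesis using assms by blast
qed

text \<open>
  Truncated subtraction makes the degree bound uniform: in degree \<open>0\<close> the derivative is the zero
  polynomial. This is why the product case treats a factor of degree \<open>0\<close> apart: the product rule
  would leave a summand \<open>f' g\<close> of nominal degree \<open>n\<close> instead of \<open>n - 1\<close>, and only
  because \<open>f\<close> is constant does this summand vanish.
\<close>

lemma polynomial_derivative:
  assumes "polynomial_of_degree_le n f"
  shows "\<exists>f'. (\<forall>x. (f has_derivative f' x) (at x)) \<and>
              (\<forall>h. polynomial_of_degree_le (n - 1) (\<lambda>x. f' x h))"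
  using assms
proof induction
  case (const n c)
  show ?case
    by (rule exI[of _ "\<lambda>x h. 0"]) (auto intro: polynomial_of_degree_le.const)
next
  case (linear l n)
  then show ?case
    by (intro exI[of _ "\<lambda>x. l"])
       (auto intro: polynomial_of_degree_le.const bounded_linear_imp_has_derivative)
next
  case (add n f g)
  then obtain f' g' where
    f': "\<And>x. (f has_derivative f' x) (at x)"
        "\<And>h. polynomial_of_degree_le (n - 1) (\<lambda>x. f' x h)" and
    g': "\<And>x. (g has_derivative g' x) (at x)"
        "\<And>h. polynomial_of_degree_le (n - 1) (\<lambda>x. g' x h)"
    by blast
  show ?case
    by (intro exI[of _ "\<lambda>x h. f' x h + g' x h"] conjI allI polynomial_of_degree_le.add
          has_derivative_add f' g')
next
  case (mult m f n g)
  then obtain f' g' where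
    f': "\<And>x. (f has_derivative f' x) (at x)"
        "\<And>h. polynomial_of_degree_le (m - 1) (\<lambda>x. f' x h)" and
    g': "\<And>x. (g has_derivative g' x) (at x)"
        "\<And>h. polynomial_of_degree_le (n - 1) (\<lambda>x. g' x h)"
    by blast
  consider "m = 0" | "n = 0" | "m > 0" "n > 0" by blast
  then show ?case
  proof cases
    case 1
    then obtain c where c: "f = (\<lambda>x. c)"
      using mult.hyps polynomial_degree_0_const by blast
    have "polynomial_of_degree_le (0 + (n - 1)) (\<lambda>x. c * g' x h)" for h
      by (intro polynomial_of_degree_le.mult polynomial_of_degree_le.const g')
    then show ?thesis
      by (intro exI[of _ "\<lambda>x h. c * g' x h"])
         (auto simp: c 1 intro: has_derivative_mult_right g')
  next
    case 2
    then obtain c where c: "g = (\<lambda>x. c)"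
      using mult.hyps polynomial_degree_0_const by blast
    have "polynomial_of_degree_le ((m - 1) + 0) (\<lambda>x. f' x h * c)" for h
      by (intro polynomial_of_degree_le.mult polynomial_of_degree_le.const f')
    then show ?thesis
      by (intro exI[of _ "\<lambda>x h. f' x h * c"])
         (auto simp: c 2 intro: has_derivative_mult_left f')
  next
    case 3
    have "polynomial_of_degree_le (m + n - 1) (\<lambda>x. f x * g' x h)" for h
      using polynomial_of_degree_le.mult[OF mult.hyps(1) g'(2)[of h]] 3 by simp
    moreover have "polynomial_of_degree_le (m + n - 1) (\<lambda>x. f' x h * g x)" for h
      using polynomial_of_degree_le.mult[OF f'(2)[of h] mult.hyps(2)] 3 by simp
    ultimately show ?thesis
      by (intro exI[of _ "\<lambda>x h. f x * g' x h + f' x h * g x"])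
         (auto intro: polynomial_of_degree_le.add has_derivative_mult f' g')
  qed
qed

lemma polynomial_dir_deriv:
  assumes "polynomial_of_degree_le n f"
  shows "polynomial_of_degree_le (n - length hs) (\<lambda>x. dir_deriv f x hs)"
proof (induction hs)
  case Nil
  then show ?case using assms by simp
next
  case (Cons h hs)
  then obtain f' where
    f': "\<And>x. ((\<lambda>x. dir_deriv f x hs) has_derivative f' x) (at x)"
        "\<And>h. polynomial_of_degree_le (n - length hs - 1) (\<lambda>x. f' x h)"
    using polynomial_derivative by blast
  have "frechet_derivative (\<lambda>x. dir_deriv f x hs) (at x) = f' x" for x
    using frechet_derivative_at[OF f'(1)] by simp
  then show ?case using f'(2)[of h] by simp
qed

lemma dir_deriv_has_derivative:
  assumes "polynomial_of_degree_le n f"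
  shows "((\<lambda>z. dir_deriv f z hs) has_derivative (\<lambda>h. dir_deriv f x (h # hs))) (at x)"
proof -
  obtain f' where f': "\<And>x. ((\<lambda>x. dir_deriv f x hs) has_derivative f' x) (at x)"
    using polynomial_derivative[OF polynomial_dir_deriv[OF assms]] by blast
  then show ?thesis
    using frechet_derivative_at[OF f'(1)[of x]] f'[of x] by simp
qed

lemma dir_deriv_line:
  assumes "polynomial_of_degree_le n f"
  shows "((\<lambda>t. dir_deriv f (x + t *\<^sub>R h) hs) has_real_derivative
          dir_deriv f (x + t *\<^sub>R h) (h # hs)) (at t)"
proof -
  let ?D = "\<lambda>v. dir_deriv f (x + t *\<^sub>R h) (v # hs)"
  note D = dir_deriv_has_derivative[OF assms, of hs "x + t *\<^sub>R h"]
  have "((\<lambda>t. x + t *\<^sub>R h) has_derivative (\<lambda>s. s *\<^sub>R h)) (at t)"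
    by (auto intro!: derivative_eq_intros)
  from has_derivative_compose[OF this D]
  have "((\<lambda>t. dir_deriv f (x + t *\<^sub>R h) hs) has_derivative (\<lambda>s. ?D (s *\<^sub>R h))) (at t)" .
  moreover have "?D (s *\<^sub>R h) = ?D h * s" for s
    using linear_scale[OF has_derivative_linear[OF D], of s h] by simp
  ultimately show ?thesis
    by (simp add: has_field_derivative_def)
qed

lemma dir_deriv_scale:
  assumes "polynomial_of_degree_le n f"
  shows "dir_deriv f x (map ((*\<^sub>R) c) hs) = c ^ length hs * dir_deriv f x hs"
proof (induction hs arbitrary: x)
  case (Cons h hs)
  let ?D = "\<lambda>v. dir_deriv f x (v # hs)"
  note D = dir_deriv_has_derivative[OF assms, of hs x]
  have "((\<lambda>z. dir_deriv f z (map ((*\<^sub>R) c) hs)) has_derivative (\<lambda>v. c ^ length hs * ?D v)) (at x)"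
    unfolding Cons.IH by (intro has_derivative_mult_right D)
  from frechet_derivative_at[OF this]
  have "dir_deriv f x (map ((*\<^sub>R) c) (h # hs)) = c ^ length hs * ?D (c *\<^sub>R h)"
    by (simp add: fun_eq_iff)
  also have "?D (c *\<^sub>R h) = c * ?D h"
    using linear_scale[OF has_derivative_linear[OF D], of c h] by simp
  finally show ?case by (simp add: algebra_simps)
qed simp

text \<open>
  The \<open>n\<close>-th derivative of a polynomial of degree at most \<open>n\<close> is constant, so the Lagrange remainder
  of order \<open>n\<close> is the \<open>n\<close>-th Taylor term itself. The list \<open>hs\<close> of directions already differentiated
  along is carried so that the expansion also serves the second derivative of \<open>f\<close>.
\<close>

lemma polynomial_taylor:
  assumes f: "polynomial_of_degree_le n f" and n: "n = m + length hs"
  shows "dir_deriv f (x + t *\<^sub>R h) hs =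
         (\<Sum>i\<le>m. dir_deriv f x (replicate i h @ hs) / fact i * t ^ i)"
proof -
  define diff where "diff i t = dir_deriv f (x + t *\<^sub>R h) (replicate i h @ hs)" for i t
  have "DERIV (diff i) t :> diff (Suc i) t" for i t
    unfolding diff_def using dir_deriv_line[OF f] by simp
  then obtain s where s: "diff 0 t = (\<Sum>i<m. diff i 0 / fact i * t ^ i) + diff m s / fact m * t ^ m"
    using Maclaurin_all_le[of diff "diff 0" t m] by blast
  have "polynomial_of_degree_le 0 (\<lambda>z. dir_deriv f z (replicate m h @ hs))"
    using polynomial_dir_deriv[OF f, of "replicate m h @ hs"] n by simp
  then obtain c where "(\<lambda>z. dir_deriv f z (replicate m h @ hs)) = (\<lambda>z. c)"
    using polynomial_degree_0_const by blast
  then have "diff m s = diff m 0"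
    unfolding diff_def by (simp add: fun_eq_iff)
  then have "diff 0 t = (\<Sum>i\<le>m. diff i 0 / fact i * t ^ i)"
    using s by (simp add: lessThan_Suc_atMost[symmetric])
  then show ?thesis by (simp add: diff_def)
qed

section \<open>Convex quartics\<close>

context
  fixes f :: "'a::real_normed_vector \<Rightarrow> real"
  assumes f_poly: "polynomial_of_degree_le 4 f"
begin

lemma quartic_form_base: "dir_deriv f x [h, h, h, h] = 24 * quartic_form f h h h h"
proof -
  have "polynomial_of_degree_le 0 (\<lambda>z. dir_deriv f z [h, h, h, h])"
    using polynomial_dir_deriv[OF f_poly, of "[h, h, h, h]"] by simp
  then obtain c where "(\<lambda>z. dir_deriv f z [h, h, h, h]) = (\<lambda>z. c)"
    using polynomial_degree_0_const by blast
  then show ?thesis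
    unfolding quartic_form_def by (simp add: fun_eq_iff del: dir_deriv.simps)
qed

lemma quartic_expansion:
  "f (x + t *\<^sub>R h) = f x + dir_deriv f x [h] * t + dir_deriv f x [h, h] / 2 * t ^ 2
     + dir_deriv f x [h, h, h] / 6 * t ^ 3 + quartic_form f h h h h * t ^ 4"
  using polynomial_taylor[OF f_poly, of 4 "[]" x t h] quartic_form_base[of x h]
  by (simp add: eval_nat_numeral field_simps del: dir_deriv.simps(2))

lemma second_derivative_expansion:
  "dir_deriv f (x + t *\<^sub>R h) [h, h] =
     dir_deriv f x [h, h] + dir_deriv f x [h, h, h] * t + 12 * quartic_form f h h h h * t ^ 2"
  using polynomial_taylor[OF f_poly, of 2 "[h, h]" x t h] quartic_form_base[of x h]
  by (simp add: eval_nat_numeral field_simps del: dir_deriv.simps(2))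

text \<open>
  In the symmetric second difference \<open>f(x + s h) + f(x - s h) - 2 f(x) \<ge> 0\<close> the odd terms cancel and
  \<open>s\<^sup>2 (b + 2 d s\<^sup>2)\<close> remains; letting \<open>s\<close> tend to \<open>0\<close> gives \<open>b \<ge> 0\<close>.
\<close>

lemma convex_quartic_second_derivative_nonneg:
  assumes "convex_on UNIV f"
  shows "0 \<le> dir_deriv f x [h, h]"
proof -
  define b where "b = dir_deriv f x [h, h]"
  define d where "d = quartic_form f h h h h"
  have ge: "0 \<le> b + 2 * d * s ^ 2" if "s > 0" for s
  proof -
    have "f ((1 / 2) *\<^sub>R (x + s *\<^sub>R h) + (1 / 2) *\<^sub>R (x + (- s) *\<^sub>R h))
        \<le> (1 / 2) * f (x + s *\<^sub>R h) + (1 / 2) * f (x + (- s) *\<^sub>R h)"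
      using convex_onD[OF assms, of "1 / 2" "x + s *\<^sub>R h" "x + (- s) *\<^sub>R h"] by simp
    moreover have "(1 / 2) *\<^sub>R (x + s *\<^sub>R h) + (1 / 2) *\<^sub>R (x + (- s) *\<^sub>R h) = x"
      by (simp add: algebra_simps flip: scaleR_left_distrib)
    ultimately have "2 * f x \<le> f (x + s *\<^sub>R h) + f (x + (- s) *\<^sub>R h)" by simp
    also have "\<dots> = 2 * f x + s ^ 2 * (b + 2 * d * s ^ 2)"
      unfolding quartic_expansion b_def d_def
      by (simp add: algebra_simps eval_nat_numeral del: dir_deriv.simps)
    finally show ?thesis using that by (simp add: zero_le_mult_iff)
  qed
  have "((\<lambda>s. b + 2 * d * s ^ 2) \<longlongrightarrow> b + 2 * d * 0 ^ 2) (at_right 0)"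
    by (intro tendsto_intros)
  moreover have "eventually (\<lambda>s. 0 \<le> b + 2 * d * s ^ 2) (at_right (0::real))"
    using ge by (auto simp: eventually_at_filter)
  ultimately have "0 \<le> b + 2 * d * 0 ^ 2"
    by (intro tendsto_lowerbound) auto
  then show ?thesis by (simp add: b_def)
qed

lemma convex_quartic_sandwich:
  assumes "convex_on UNIV f" and "0 < \<tau>"
  shows "f (x + h) \<le> f x + dir_deriv f x [h] + (1 + 3 * \<tau>) / (6 * \<tau>) * dir_deriv f x [h, h]
           + (1 + 2 * \<tau>) * quartic_form f h h h h" (is ?upper)
    and "f x + dir_deriv f x [h] + (3 * \<tau> - 1) / (6 * \<tau>) * dir_deriv f x [h, h]
           + (1 - 2 * \<tau>) * quartic_form f h h h h \<le> f (x + h)" (is ?lower)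
proof -
  define b c d where "b = dir_deriv f x [h, h]"
    and "c = dir_deriv f x [h, h, h]" and "d = quartic_form f h h h h"
  have nonneg: "0 \<le> b + c * t + 12 * d * t ^ 2" for t
    using convex_quartic_second_derivative_nonneg[OF assms(1), of "x + t *\<^sub>R h" h]
    unfolding second_derivative_expansion b_def c_def d_def .
  have "c * \<tau> \<le> b + 12 * d * \<tau> ^ 2" "- c * \<tau> \<le> b + 12 * d * \<tau> ^ 2"
    using nonneg[of \<tau>] nonneg[of "-\<tau>"] by (simp_all add: algebra_simps)
  then have c: "c / 6 \<le> b / (6 * \<tau>) + 2 * d * \<tau>" "- c / 6 \<le> b / (6 * \<tau>) + 2 * d * \<tau>"
    using assms(2) by (simp_all add: field_simps power2_eq_square)
  have eq: "f (x + h) = f x + dir_deriv f x [h] + b / 2 + c / 6 + d"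
    using quartic_expansion[of x 1 h] by (simp add: b_def c_def d_def del: dir_deriv.simps)
  have coeff: "(1 + 3 * \<tau>) / (6 * \<tau>) * b = b / 2 + b / (6 * \<tau>)"
    "(3 * \<tau> - 1) / (6 * \<tau>) * b = b / 2 - b / (6 * \<tau>)"
    using assms(2) by (simp_all add: field_simps)
  show ?upper
    using c(1) unfolding eq b_def[symmetric] d_def[symmetric] coeff by (simp add: algebra_simps)
  show ?lower
    using c(2) unfolding eq b_def[symmetric] d_def[symmetric] coeff by (simp add: algebra_simps)
qed

section \<open>The relaxed model\<close>

lemma relaxed_model_majorizes:
  assumes "convex_on UNIV f" and "0 < \<tau>"
    and upper: "\<And>z. quartic_form f z z z z \<le> L * norm z ^ 4"
  shows "f y \<le> relaxed_model f L \<tau> x y"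
proof -
  have "(1 + 2 * \<tau>) * quartic_form f (y - x) (y - x) (y - x) (y - x)
      \<le> (1 + 2 * \<tau>) * (L * norm (y - x) ^ 4)"
    using assms(2) by (intro mult_left_mono upper) auto
  then show ?thesis
    using convex_quartic_sandwich(1)[OF assms(1,2), of x "y - x"]
    unfolding relaxed_model_def by (simp add: mult.assoc del: dir_deriv.simps)
qed

lemma relaxed_model_shortened_step:
  assumes "convex_on UNIV f" and tau: "0 < \<tau>" "\<tau> < 1 / 2" and "0 < \<alpha>"
    and lower: "\<And>z. \<mu> * norm z ^ 4 \<le> quartic_form f z z z z"
    and quadratic: "\<alpha> * (3 * \<tau> + 1) \<le> 3 * \<tau> - 1"
    and quartic: "\<alpha> ^ 3 * ((1 + 2 * \<tau>) * L) \<le> (1 - 2 * \<tau>) * \<mu>"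
  shows "relaxed_model f L \<tau> x (x + \<alpha> *\<^sub>R (z - x)) \<le> (1 - \<alpha>) * f x + \<alpha> * f z"
proof -
  define h where "h = z - x"
  define a b d where "a = dir_deriv f x [h]" and "b = dir_deriv f x [h, h]"
    and "d = quartic_form f h h h h"
  have "b \<ge> 0"
    unfolding b_def using convex_quartic_second_derivative_nonneg[OF assms(1)] .
  then have "\<alpha> * (3 * \<tau> + 1) / (6 * \<tau>) * b \<le> (3 * \<tau> - 1) / (6 * \<tau>) * b"
    using tau quadratic by (intro mult_right_mono divide_right_mono) auto
  moreover have "\<alpha> ^ 3 * ((1 + 2 * \<tau>) * L) * norm h ^ 4 \<le> (1 - 2 * \<tau>) * d"
  proof -
    have "\<alpha> ^ 3 * ((1 + 2 * \<tau>) * L) * norm h ^ 4 \<le> (1 - 2 * \<tau>) * \<mu> * norm h ^ 4"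
      using quartic by (intro mult_right_mono) auto
    also have "\<dots> \<le> (1 - 2 * \<tau>) * d"
      unfolding mult.assoc d_def using tau by (intro mult_left_mono lower) auto
    finally show ?thesis .
  qed
  moreover have "f x + a + (3 * \<tau> - 1) / (6 * \<tau>) * b + (1 - 2 * \<tau>) * d \<le> f z"
    using convex_quartic_sandwich(2)[OF assms(1,2), of x h]
    by (simp add: a_def b_def d_def h_def del: dir_deriv.simps)
  ultimately have slope: "a + \<alpha> * (3 * \<tau> + 1) / (6 * \<tau>) * b
      + \<alpha> ^ 3 * ((1 + 2 * \<tau>) * L) * norm h ^ 4 \<le> f z - f x"
    by linarith
  have "dir_deriv f x [\<alpha> *\<^sub>R h] = \<alpha> * a" "dir_deriv f x [\<alpha> *\<^sub>R h, \<alpha> *\<^sub>R h] = \<alpha> ^ 2 * b"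
    using dir_deriv_scale[OF f_poly, of x \<alpha> "[h]"] dir_deriv_scale[OF f_poly, of x \<alpha> "[h, h]"]
    unfolding a_def b_def by (simp_all add: power2_eq_square del: dir_deriv.simps)
  then have "relaxed_model f L \<tau> x (x + \<alpha> *\<^sub>R h) = f x + \<alpha> * a
      + (1 + 3 * \<tau>) / (6 * \<tau>) * (\<alpha> ^ 2 * b) + (1 + 2 * \<tau>) * L * (\<alpha> * norm h) ^ 4"
    using \<open>0 < \<alpha>\<close> unfolding relaxed_model_def by (simp del: dir_deriv.simps)
  also have "\<dots> = f x + \<alpha> * (a + \<alpha> * (3 * \<tau> + 1) / (6 * \<tau>) * b
      + \<alpha> ^ 3 * ((1 + 2 * \<tau>) * L) * norm h ^ 4)"
    using tau by (simp add: field_simps eval_nat_numeral)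
  also have "\<dots> \<le> f x + \<alpha> * (f z - f x)"
    using slope \<open>0 < \<alpha>\<close> by (intro add_left_mono mult_left_mono) auto
  finally show ?thesis
    by (simp add: h_def algebra_simps)
qed

end

section \<open>Linear convergence\<close>

theorem theorem4:
  fixes f \<psi> F :: "'a::real_normed_vector \<Rightarrow> real"
    and dom_\<psi> :: "'a set"
    and x :: "nat \<Rightarrow> 'a"
    and \<mu> L q \<tau> \<alpha> Fstar :: real
  assumes finite_dim: "\<exists>B :: 'a set. finite B \<and> span B = UNIV"
    and f_poly: "polynomial_of_degree_le 4 f"
    and f_convex: "convex_on UNIV f"
    and f4_pos_def: "\<And>z. z \<noteq> 0 \<Longrightarrow> quartic_form f z z z z > 0"
    and mu_L: "0 < \<mu>" "\<mu> \<le> L"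
    and f4_lower: "\<And>z. \<mu> * norm z ^ 4 \<le> quartic_form f z z z z"
    and f4_upper: "\<And>z. quartic_form f z z z z \<le> L * norm z ^ 4"
    and q_def: "q = \<mu> / L"
    and psi: "closed_convex_function dom_\<psi> \<psi>"
    and F_def: "F = (\<lambda>z. f z + \<psi> z)"
    and Fstar_def: "Fstar = (INF z\<in>dom_\<psi>. F z)"
    and tau: "1 / 3 < \<tau>" "\<tau> < 1 / 2"
    and method_seq: "relaxed_quartic_newton f dom_\<psi> \<psi> L \<tau> x"
    and alpha_pos: "0 < \<alpha>"
    and alpha_le: "\<alpha> \<le> min ((3 * \<tau> - 1) / (3 * \<tau> + 1))
                           ((q * ((1 - 2 * \<tau>) / (1 + 2 * \<tau>))) powr (1 / 3))"
  shows "\<forall>k. F (x k) - Fstar \<le> (1 - \<alpha>) ^ k * (F (x 0) - Fstar)"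
proof -
  have tau_pos: "0 < \<tau>" and L_pos: "0 < L" using tau mu_L by linarith+
  have quadratic: "\<alpha> * (3 * \<tau> + 1) \<le> 3 * \<tau> - 1"
    using alpha_le tau_pos by (simp add: pos_le_divide_eq)
  have "(3 * \<tau> - 1) / (3 * \<tau> + 1) < 1" using tau_pos by simp
  then have alpha_lt_1: "\<alpha> < 1" using alpha_le by linarith
  define r where "r = q * ((1 - 2 * \<tau>) / (1 + 2 * \<tau>))"
  have "0 < r" unfolding r_def q_def using tau mu_L L_pos by simp
  have "\<alpha> ^ 3 \<le> (r powr (1 / 3)) ^ 3"
    using alpha_le alpha_pos unfolding r_def by (intro power_mono) auto
  also have "\<dots> = r"
    using \<open>0 < r\<close> by (simp add: powr_powr flip: powr_realpow)
  finally have "\<alpha> ^ 3 * ((1 + 2 * \<tau>) * L) \<le> r * ((1 + 2 * \<tau>) * L)"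
    using tau_pos L_pos by (intro mult_right_mono) auto
  also have "\<dots> = (1 - 2 * \<tau>) * \<mu>"
  proof -
    have "\<mu> / L * (u / v) * (v * L) = u * \<mu>" if "0 < v" for u v
      using that L_pos by simp
    then show ?thesis unfolding r_def q_def using tau_pos by simp
  qed
  finally have quartic: "\<alpha> ^ 3 * ((1 + 2 * \<tau>) * L) \<le> (1 - 2 * \<tau>) * \<mu>" .

  have psi_convex: "convex_on dom_\<psi> \<psi>" and nonempty: "dom_\<psi> \<noteq> {}"
    using psi unfolding closed_convex_function_def by auto
  have min: "is_arg_min (\<lambda>y. relaxed_model f L \<tau> (x k) y + \<psi> y) (\<lambda>y. y \<in> dom_\<psi>) (x (Suc k))" for k
    using method_seq unfolding relaxed_quartic_newton_def by blast
  have x_in: "x k \<in> dom_\<psi>" for k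
    using method_seq min unfolding relaxed_quartic_newton_def is_arg_min_def by (cases k) auto

  have step: "F (x (Suc k)) \<le> (1 - \<alpha>) * F (x k) + \<alpha> * F z" if z: "z \<in> dom_\<psi>" for k z
  proof -
    define y where "y = x k + \<alpha> *\<^sub>R (z - x k)"
    have y: "y = (1 - \<alpha>) *\<^sub>R x k + \<alpha> *\<^sub>R z"
      unfolding y_def by (simp add: algebra_simps)
    have "convex dom_\<psi>" using psi_convex by (rule convex_on_imp_convex)
    then have "y \<in> dom_\<psi>"
      unfolding y using x_in z alpha_pos alpha_lt_1 by (intro convexD) auto
    have "F (x (Suc k)) \<le> relaxed_model f L \<tau> (x k) (x (Suc k)) + \<psi> (x (Suc k))"
      unfolding F_def
      using relaxed_model_majorizes[OF f_poly f_convex tau_pos f4_upper] by simp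
    also have "\<dots> \<le> relaxed_model f L \<tau> (x k) y + \<psi> y"
      using min[of k] \<open>y \<in> dom_\<psi>\<close> unfolding is_arg_min_def by (auto simp: not_less)
    also have "\<dots> \<le> ((1 - \<alpha>) * f (x k) + \<alpha> * f z) + ((1 - \<alpha>) * \<psi> (x k) + \<alpha> * \<psi> z)"
    proof (rule add_mono)
      show "relaxed_model f L \<tau> (x k) y \<le> (1 - \<alpha>) * f (x k) + \<alpha> * f z"
        unfolding y_def
        by (rule relaxed_model_shortened_step[OF f_poly f_convex tau_pos tau(2) alpha_pos
              f4_lower quadratic quartic])
      show "\<psi> y \<le> (1 - \<alpha>) * \<psi> (x k) + \<alpha> * \<psi> z"
        unfolding y using alpha_pos alpha_lt_1
        by (intro convex_onD[OF psi_convex]) (auto simp: x_in z)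
    qed
    also have "\<dots> = (1 - \<alpha>) * F (x k) + \<alpha> * F z"
      by (simp add: F_def algebra_simps)
    finally show ?thesis .
  qed

  \<comment> \<open>Solved for \<open>F z\<close>, the step inequality is a lower bound of \<open>F\<close> that is uniform in \<open>z\<close>, hence a
     lower bound of the infimum.\<close>
  have contract: "F (x (Suc k)) - Fstar \<le> (1 - \<alpha>) * (F (x k) - Fstar)" for k
  proof -
    have "(F (x (Suc k)) - (1 - \<alpha>) * F (x k)) / \<alpha> \<le> Fstar"
      unfolding Fstar_def
    proof (rule cINF_greatest[OF nonempty])
      fix z assume "z \<in> dom_\<psi>"
      then show "(F (x (Suc k)) - (1 - \<alpha>) * F (x k)) / \<alpha> \<le> F z"
        using step[of z k] alpha_pos by (simp add: field_simps)
    qed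
    then show ?thesis using alpha_pos by (simp add: field_simps)
  qed
  show ?thesis
  proof
    fix k
    show "F (x k) - Fstar \<le> (1 - \<alpha>) ^ k * (F (x 0) - Fstar)"
    proof (induction k)
      case (Suc k)
      have "F (x (Suc k)) - Fstar \<le> (1 - \<alpha>) * (F (x k) - Fstar)" by (rule contract)
      also have "\<dots> \<le> (1 - \<alpha>) * ((1 - \<alpha>) ^ k * (F (x 0) - Fstar))"
        using Suc alpha_lt_1 by (intro mult_left_mono) auto
      finally show ?case by (simp add: mult.assoc)
    qed simp
  qed
qed

end
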